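(* Let $k \geq 2$ be an integer such that $2k+1$ is prime, and let $w$ be the word $x_1^2[x_1^{-2}, x_2^{-1}]^k$ in the free group $F_2$ on $x_1,x_2$. Let $p \ne 2k+1$ be an odd prime such that $p^2 \not\equiv 1 \bmod 16$ and $p^2 \not\equiv 1 \bmod (2k+1)$, and let $m$ be the smallest positive integer with $p^{2m} \equiv 1 \bmod (2k+1)$. Then the word map $(x,y) \mapsto w(x,y)$ is non-surjective on $\mathrm{PSL}_2(q)$ for all $q = p^n$ where $n$ is a positive integer not divisible by $2$ or by $m$.
   Context: Commutator convention: $[a,b] = a^{-1}b^{-1}ab$, so $[x_1^{-2},x_2^{-1}] = x_1^{2}x_2x_1^{-2}x_2^{-1}$. For a group $G$ and a word $w = w(x_1,x_2)\in F_2$, the word map on $G$ is the map $G\times G \to G$, $(x,y)\mapsto w(x,y)$, obtained by substituting $x$ for $x_1$ and $y$ for $x_2$; it is non-surjective on $G$ if its image is not all of $G$. $\mathrm{PSL}_2(q)=\mathrm{SL}_2(\mathbb{F}_q)/\{\pm I\}$. *)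

theory Defs
  imports
    "HOL-Analysis.Determinants"
    "HOL-Algebra.Coset"
    "HOL-Number_Theory.Cong"
    "HOL-Computational_Algebra.Primes"
begin

text \<open>A letter \<open>(x, True)\<close> stands for the generator \<open>x\<close>, and \<open>(x, False)\<close> for its inverse.
  Elements of the free group are the reduced words.\<close>

definition cancels :: "'g \<times> bool \<Rightarrow> 'g \<times> bool \<Rightarrow> bool" where
  "cancels a b \<longleftrightarrow> fst a = fst b \<and> snd a \<noteq> snd b"

definition reduced :: "('g \<times> bool) list \<Rightarrow> bool" where
  "reduced u \<longleftrightarrow> successively (\<lambda>a b. \<not> cancels a b) u"

fun cons_reduce :: "'g \<times> bool \<Rightarrow> ('g \<times> bool) list \<Rightarrow> ('g \<times> bool) list" where
  "cons_reduce a [] = [a]"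
| "cons_reduce a (b # u) = (if cancels a b then u else a # b # u)"

definition free_group :: "('g \<times> bool) list monoid" where
  "free_group = \<lparr>carrier = {u. reduced u}, mult = foldr cons_reduce, one = []\<rparr>"

lemma reduced_Nil [simp]: "reduced []"
  by (simp add: reduced_def)

lemma reduced_ConsD: "reduced (a # u) \<Longrightarrow> reduced u"
  by (cases u) (auto simp: reduced_def)

lemma reduced_cons_reduce: "reduced u \<Longrightarrow> reduced (cons_reduce a u)"
  by (cases u) (auto simp: reduced_def successively_Cons)

lemma reduced_foldr: "reduced v \<Longrightarrow> reduced (foldr cons_reduce u v)"
  by (induction u) (auto intro: reduced_cons_reduce)

lemma cons_reduce_reduced: "reduced (a # u) \<Longrightarrow> cons_reduce a u = a # u"
  by (cases u) (auto simp: reduced_def)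

lemma cons_reduce_cancel:
  assumes "cancels a b" "reduced u"
  shows "cons_reduce a (cons_reduce b u) = u"
proof (cases u)
  case Nil
  then show ?thesis using assms by simp
next
  case (Cons c v)
  show ?thesis
  proof (cases "cancels b c")
    case True
    then have "a = c" using assms(1) by (auto simp: cancels_def prod_eq_iff)
    then show ?thesis using True Cons assms(2) by (simp add: cons_reduce_reduced)
  next
    case False
    then show ?thesis using Cons assms(1) by simp
  qed
qed

lemma foldr_cons_reduce:
  assumes "reduced u" "reduced v"
  shows "foldr cons_reduce (cons_reduce a u) v = cons_reduce a (foldr cons_reduce u v)"
  using assms by (cases u) (auto simp: cons_reduce_cancel reduced_foldr dest: reduced_ConsD)

lemma foldr_cons_reduce_assoc:
  assumes "reduced v" "reduced z"
  shows "foldr cons_reduce (foldr cons_reduce u v) z = foldr cons_reduce u (foldr cons_reduce v z)"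
  using assms by (induction u) (auto simp: foldr_cons_reduce reduced_foldr)

lemma foldr_cons_reduce_Nil: "reduced u \<Longrightarrow> foldr cons_reduce u [] = u"
proof (induction u)
  case (Cons a u)
  then show ?case by (simp add: reduced_ConsD cons_reduce_reduced)
qed simp

lemma foldr_cons_reduce_inverse:
  "reduced v \<Longrightarrow>
    foldr cons_reduce (map (map_prod id Not) (rev u)) (foldr cons_reduce u v) = v"
proof (induction u)
  case (Cons a u)
  then show ?case
    by (simp add: cons_reduce_cancel reduced_foldr cancels_def)
qed simp

lemma group_free_group: "group (free_group :: ('g \<times> bool) list monoid)"
proof (rule groupI)
  fix u :: "('g \<times> bool) list"
  assume "u \<in> carrier free_group"
  then have u: "reduced u" by (simp add: free_group_def)
  define v where "v = foldr cons_reduce (map (map_prod id Not) (rev u)) []"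
  have "foldr cons_reduce v u = foldr cons_reduce (map (map_prod id Not) (rev u)) u"
    using foldr_cons_reduce_assoc[of "[]" u] u by (simp add: v_def)
  also have "\<dots> = []"
    using foldr_cons_reduce_inverse[of "[]" u] u by (simp add: foldr_cons_reduce_Nil)
  finally have "v \<otimes>\<^bsub>free_group\<^esub> u = \<one>\<^bsub>free_group\<^esub>"
    by (simp add: free_group_def)
  moreover have "v \<in> carrier free_group"
    by (simp add: free_group_def v_def reduced_foldr)
  ultimately show "\<exists>v\<in>carrier free_group. v \<otimes>\<^bsub>free_group\<^esub> u = \<one>\<^bsub>free_group\<^esub>"
    by blast
qed (auto simp: free_group_def reduced_foldr foldr_cons_reduce_assoc)

datatype gen2 = X1 | X2

abbreviation F2 :: "(gen2 \<times> bool) list monoid" where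
  "F2 \<equiv> free_group"

abbreviation x1 :: "(gen2 \<times> bool) list" where "x1 \<equiv> [(X1, True)]"
abbreviation x2 :: "(gen2 \<times> bool) list" where "x2 \<equiv> [(X2, True)]"

definition word_eval :: "('a, 'b) monoid_scheme \<Rightarrow> ('g \<Rightarrow> 'a) \<Rightarrow> ('g \<times> bool) list \<Rightarrow> 'a" where
  "word_eval G f u =
    foldr (\<lambda>(g, pos) r. (if pos then f g else inv\<^bsub>G\<^esub> (f g)) \<otimes>\<^bsub>G\<^esub> r) u \<one>\<^bsub>G\<^esub>"

definition word_map :: "('a, 'b) monoid_scheme \<Rightarrow> (gen2 \<times> bool) list \<Rightarrow> 'a \<times> 'a \<Rightarrow> 'a" where
  "word_map G w = (\<lambda>(x, y). word_eval G (case_gen2 x y) w)"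

definition word_map_surjective :: "('a, 'b) monoid_scheme \<Rightarrow> (gen2 \<times> bool) list \<Rightarrow> bool" where
  "word_map_surjective G w \<longleftrightarrow> word_map G w ` (carrier G \<times> carrier G) = carrier G"

definition commutator :: "('a, 'b) monoid_scheme \<Rightarrow> 'a \<Rightarrow> 'a \<Rightarrow> 'a" where
  "commutator G a b = inv\<^bsub>G\<^esub> a \<otimes>\<^bsub>G\<^esub> inv\<^bsub>G\<^esub> b \<otimes>\<^bsub>G\<^esub> a \<otimes>\<^bsub>G\<^esub> b"

definition power_commutator_word :: "nat \<Rightarrow> (gen2 \<times> bool) list" where
  "power_commutator_word k =
    x1 [^]\<^bsub>F2\<^esub> (2::nat) \<otimes>\<^bsub>F2\<^esub>
      commutator F2 (x1 [^]\<^bsub>F2\<^esub> (-2::int)) (inv\<^bsub>F2\<^esub> x2) [^]\<^bsub>F2\<^esub> k"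

context group
begin

lemma word_eval_closed:
  assumes "range f \<subseteq> carrier G"
  shows "word_eval G f u \<in> carrier G"
proof -
  have "f g \<in> carrier G" for g using assms by auto
  then show ?thesis by (induction u) (auto simp: word_eval_def)
qed

lemma word_eval_cons_reduce:
  assumes "range f \<subseteq> carrier G"
  shows "word_eval G f (cons_reduce a u) = word_eval G f (a # u)"
proof (cases u)
  case (Cons b v)
  have f: "f g \<in> carrier G" for g using assms by auto
  have "word_eval G f (a # b # v) = word_eval G f v" if "cancels a b"
    using that word_eval_closed[OF assms, of v] f
    by (cases a; cases b) (auto simp: cancels_def word_eval_def simp flip: m_assoc)
  then show ?thesis using Cons by auto
qed simp

lemma word_eval_hom:
  assumes "range f \<subseteq> carrier G"
  shows "word_eval G f \<in> hom free_group G"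
proof (rule homI)
  fix u v
  have f: "f g \<in> carrier G" for g using assms by auto
  have c: "word_eval G f v \<in> carrier G" for v using word_eval_closed[OF assms] .
  have "word_eval G f (foldr cons_reduce u v) = word_eval G f u \<otimes> word_eval G f v"
  proof (induction u)
    case Nil
    then show ?case using c[of v] by (simp add: word_eval_def[of G f "[]"])
  next
    case (Cons a u)
    then show ?case using c[of u] c[of v] f
      by (cases a) (simp add: word_eval_cons_reduce[OF assms],
          simp add: word_eval_def m_assoc)
  qed
  then show "word_eval G f (u \<otimes>\<^bsub>free_group\<^esub> v) = word_eval G f u \<otimes> word_eval G f v"
    by (simp add: free_group_def)
qed (rule word_eval_closed[OF assms])

lemma word_map_power_commutator_word:
  assumes x: "x \<in> carrier G" and y: "y \<in> carrier G"
  shows "word_map G (power_commutator_word k) (x, y) =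
    x [^] (2::nat) \<otimes> (x [^] (2::nat) \<otimes> y \<otimes> inv (x [^] (2::nat)) \<otimes> inv y) [^] k"
proof -
  let ?f = "case_gen2 x y"
  let ?h = "word_eval G ?f"
  have r: "range ?f \<subseteq> carrier G" using x y by (auto split: gen2.splits)
  interpret F: group F2 by (rule group_free_group)
  interpret h: group_hom F2 G ?h
    using word_eval_hom[OF r] by unfold_locales
  have [simp]: "x1 \<in> carrier F2" "x2 \<in> carrier F2"
    by (auto simp: free_group_def reduced_def)
  have [simp]: "?h x1 = x" "?h x2 = y" using x y by (auto simp: word_eval_def)
  have *: "x1 [^]\<^bsub>F2\<^esub> (-2::int) = inv\<^bsub>F2\<^esub> (x1 [^]\<^bsub>F2\<^esub> (2::nat))"
    using F.int_pow_neg_int[of x1 2] by simp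
  show ?thesis
    using x y
    by (simp add: word_map_def power_commutator_word_def commutator_def * h.hom_nat_pow)
qed

end

definition SL2 :: "('a::field ^ 2 ^ 2) monoid" where
  "SL2 = \<lparr>carrier = {A. det A = 1}, mult = (**), one = mat 1\<rparr>"

definition PSL2 :: "('a::field ^ 2 ^ 2) set monoid" where
  "PSL2 = SL2 Mod {mat 1, - mat 1}"

lemma group_SL2: "group (SL2 :: ('a::field ^ 2 ^ 2) monoid)"
proof (rule groupI)
  fix A :: "'a ^ 2 ^ 2"
  assume "A \<in> carrier SL2"
  then have A: "det A = 1" by (simp add: SL2_def)
  then obtain B where B: "B ** A = mat 1"
    using invertible_det_nz[of A] by (auto simp: invertible_def)
  have "det B = 1" using arg_cong[OF B, of det] A by (simp add: det_mul)
  then show "\<exists>B\<in>carrier SL2. B \<otimes>\<^bsub>SL2\<^esub> A = \<one>\<^bsub>SL2\<^esub>"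
    using B by (auto simp: SL2_def)
qed (auto simp: SL2_def det_mul matrix_mul_assoc)

lemma minus_one_mult:
  fixes A :: "'a::comm_ring_1 ^ 2 ^ 2"
  shows "- mat 1 ** A = - A" "A ** - mat 1 = - A"
  by (simp_all add: vec_eq_iff matrix_matrix_mult_def mat_def sum_2 forall_2)

lemma normal_center_SL2: "{mat 1, - mat 1} \<lhd> (SL2 :: ('a::field ^ 2 ^ 2) monoid)"
proof -
  interpret group "SL2 :: ('a ^ 2 ^ 2) monoid" by (rule group_SL2)
  have d: "det (- mat 1 :: 'a ^ 2 ^ 2) = 1"
    by (simp add: det_2 mat_def)
  have mm: "- mat 1 ** - mat 1 = (mat 1 :: 'a ^ 2 ^ 2)"
    by (simp add: minus_one_mult)
  have i: "inv\<^bsub>SL2\<^esub> (- mat 1 :: 'a ^ 2 ^ 2) = - mat 1"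
    by (rule inv_equality) (auto simp: SL2_def d mm)
  have o: "inv\<^bsub>SL2\<^esub> (mat 1 :: 'a ^ 2 ^ 2) = mat 1"
    using inv_one by (simp add: SL2_def)
  have "subgroup {mat 1, - mat 1} (SL2 :: ('a ^ 2 ^ 2) monoid)"
    by (rule subgroupI) (auto simp: i o, auto simp: SL2_def d mm)
  then show ?thesis
    by (rule normalI)
      (auto simp: r_coset_def l_coset_def, auto simp: SL2_def minus_one_mult)
qed

lemma group_PSL2: "group (PSL2 :: ('a::field ^ 2 ^ 2) set monoid)"
  unfolding PSL2_def by (rule normal.factorgroup_is_group[OF normal_center_SL2])

end

theory Submission
  imports
    Defs
    "HOL-Algebra.Algebraic_Closure_Type"
    "HOL-Number_Theory.Pocklington"
begin

text \<open>
  Write \<open>q = p\<^sup>n\<close> and \<open>l = 2 * k + 1\<close>. In \<open>SL\<^sub>2(q)\<close> the value of the word at \<open>(x, y)\<close> is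
  \<open>a c\<^sup>k\<close> with \<open>a = x\<^sup>2\<close> and \<open>c = a (y a\<inverse> y\<inverse>)\<close>. The second factor of \<open>c\<close> has the same trace as \<open>a\<close>,
  and this forces the trace of \<open>a c\<^sup>k\<close> to factor as \<open>tr a\<close> times a polynomial in \<open>tr c\<close>
  (\<open>trace_mult_commutator_pow\<close>). Neither factor vanishes on \<open>F\<^sub>q\<close>, so no value of the word has trace
  zero. As \<open>SL\<^sub>2(q)\<close> does contain matrices of trace zero, and trace zero is insensitive to sign,
  the word map on \<open>PSL\<^sub>2(q)\<close> misses their images (\<open>word_map_not_surjective_PSL2_if_trace_nonzero\<close>).

  The first factor is \<open>tr a = (tr x)\<^sup>2 - 2\<close>, and 2 is not a square in \<open>F\<^sub>q\<close>: the condition on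
  \<open>p\<close> modulo 16 says that \<open>p\<close> is 3 or 5 modulo 8, and so is its odd power \<open>q\<close>.

  For the second factor, write \<open>tr c = v + v\<inverse>\<close> with \<open>v\<close> in the algebraic closure. Up to a power of
  \<open>v\<close> the factor is the geometric sum of the powers \<open>(- v)\<^sup>i\<close> for \<open>i < l\<close>
  (\<open>trace_factor_geometric_sum\<close>). So at a zero either \<open>- v\<close> is a primitive \<open>l\<close>-th root of unity, or
  \<open>v = - 1\<close> and \<open>l = 0\<close> in \<open>F\<^sub>q\<close>, which is excluded by \<open>p \<noteq> l\<close>. In the former case,
  since \<open>v + v\<inverse>\<close> lies in \<open>F\<^sub>q\<close>, the order of \<open>v\<close> divides \<open>q - 1\<close> or \<open>q + 1\<close> (\<open>torus_element_order\<close>).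
  Hence \<open>l\<close> divides \<open>q\<^sup>2 - 1\<close>, that is, the order \<open>m\<close> of \<open>p\<^sup>2\<close> modulo \<open>l\<close> divides \<open>n\<close>,
  contrary to assumption.
\<close>

(* From here on, prime is the predicate on numbers, not the one on elements of a monoid. *)
hide_const (open) Divisibility.prime

section \<open>Sums of an element and its inverse in a finite field\<close>

lemma power_card_eq_self:
  fixes x :: "'a :: {field, finite}"
  shows "x ^ CARD('a) = x"
proof (cases "x = 0")
  case False
  have "bij_betw ((*) x) (UNIV - {0}) (UNIV - {0})"
    by (rule bij_betw_byWitness[where f' = "\<lambda>y. y / x"]) (use False in auto)
  then have "(\<Prod>y\<in>UNIV - {0}. x * y) = \<Prod>(UNIV - {0})"
    by (rule prod.reindex_bij_betw)
  then have "x ^ (CARD('a) - 1) = 1"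
    by (simp add: prod.distrib card_Diff_singleton)
  then have "x ^ Suc (CARD('a) - 1) = x"
    by (simp only: power_Suc mult_1_right)
  moreover have "Suc (CARD('a) - 1) = CARD('a)"
    using finite_UNIV_card_ge_0[where 'a = 'a] by simp
  ultimately show ?thesis by (simp only:)
qed simp

lemma CHAR_eq_if_card_prime_power:
  assumes "CARD('a :: {field, finite}) = p ^ n" and "prime p"
  shows "CHAR('a) = p"
proof -
  have "prime CHAR('a)"
    by (rule prime_CHAR_semidom) (simp add: finite_imp_CHAR_pos)
  moreover have "CHAR('a) dvd p ^ n"
    using CHAR_dvd_CARD[where 'a = 'a] assms(1) by simp
  ultimately show ?thesis
    using assms(2) prime_dvd_power primes_dvd_imp_eq by blast
qed

lemma obtain_add_inverse_eq:
  fixes z :: "'a :: field"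
  obtains v :: "'a alg_closure" where "v \<noteq> 0" and "v + inverse v = to_ac z"
proof -
  let ?P = "[:1, - to_ac z, 1:]"
  obtain v where v: "poly ?P v = 0"
    using alg_closed_imp_poly_has_root[of ?P] by auto
  then have "v \<noteq> 0" by auto
  moreover have "v + inverse v = to_ac z"
    using v \<open>v \<noteq> 0\<close> by (simp add: field_simps)
  ultimately show ?thesis using that by blast
qed

text \<open>Both \<open>v\<close> and \<open>w\<close> are roots of \<open>X\<^sup>2 - (v + v\<inverse>) X + 1\<close>, whose roots are \<open>v\<close> and \<open>v\<inverse>\<close>.\<close>

lemma add_inverse_eq_add_inverseD:
  fixes v w :: "'a :: field"
  assumes "w + inverse w = v + inverse v" and "v \<noteq> 0" and "w \<noteq> 0"
  shows "w = v \<or> w * v = 1"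
proof -
  have "(w - v) * (w * v - 1) = (w + w' - (v + v')) * (w * v) - (w * w' - 1) * v + (v * v' - 1) * w"
    for v' w'
    by (simp add: algebra_simps)
  from this[of "inverse w" "inverse v"] have "(w - v) * (w * v - 1) = 0"
    using assms by simp
  then show ?thesis by simp
qed

text \<open>
  The Frobenius map \<open>x \<mapsto> x\<^sup>q\<close> fixes \<open>z\<close>, so it permutes the two roots \<open>v\<close> and \<open>v\<inverse>\<close> of
  \<open>X\<^sup>2 - z X + 1\<close>. The two alternatives are the orders of the split and of the nonsplit maximal
  torus of \<open>SL\<^sub>2(q)\<close>.
\<close>

lemma torus_element_order:
  fixes z :: "'a :: {field, finite}" and v :: "'a alg_closure"
  assumes q: "CARD('a) = p ^ n" "prime p"
    and v: "v \<noteq> 0" "v + inverse v = to_ac z"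
  shows "v ^ (p ^ n - 1) = 1 \<or> v ^ (p ^ n + 1) = 1"
proof -
  let ?q = "p ^ n"
  have "v ^ ?q + inverse v ^ ?q = (v + inverse v) ^ ?q"
    by (rule freshmans_dream'[symmetric, where n = n])
      (simp_all add: CHAR_eq_if_card_prime_power[OF q] q)
  also have "\<dots> = to_ac (z ^ ?q)"
    by (simp add: v)
  also have "z ^ ?q = z"
    using power_card_eq_self[of z] q by simp
  finally have "v ^ ?q + inverse (v ^ ?q) = v + inverse v"
    by (simp add: v power_inverse)
  then consider "v ^ ?q = v" | "v ^ ?q * v = 1"
    using add_inverse_eq_add_inverseD[of "v ^ ?q" v] v(1) by auto
  then show ?thesis
  proof cases
    case 1
    have "?q = Suc (?q - 1)" using prime_gt_0_nat[OF q(2)] by simp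
    then have "v ^ (?q - 1) * v = v" using 1 by (metis power_Suc2)
    then show ?thesis using v(1) by simp
  next
    case 2
    then show ?thesis by (simp add: mult.commute)
  qed
qed

text \<open>
  A square root \<open>s\<close> of 2 is \<open>v + v\<inverse>\<close> for a primitive eighth root of unity \<open>v\<close>. Then 8
  would divide \<open>q - 1\<close> or \<open>q + 1\<close>.
\<close>

lemma two_not_square:
  fixes s :: "'a :: {field, finite}"
  assumes q: "CARD('a) = p ^ n" "prime p" and mod8: "p ^ n mod 8 \<in> {3, 5}"
  shows "s ^ 2 \<noteq> 2"
proof
  assume s: "s ^ 2 = 2"
  have "(2 :: 'a) \<noteq> 0"
  proof
    assume "(2 :: 'a) = 0"
    then have "of_nat 2 = (0 :: 'a)" by simp
    then have "p dvd 2"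
      by (simp only: of_nat_eq_0_iff_char_dvd CHAR_eq_if_card_prime_power[OF q])
    then have "p = 2"
      using primes_dvd_imp_eq[OF q(2) two_is_prime_nat] by blast
    then have "even (p ^ n)"
      using CHAR_dvd_CARD[where 'a = 'a] by (simp add: CHAR_eq_if_card_prime_power[OF q] q)
    then show False
      using mod8 unfolding insert_iff empty_iff by presburger
  qed
  then have two: "(2 :: 'a alg_closure) \<noteq> 0"
    by (metis to_ac_numeral to_ac_eq_0_iff)
  obtain v :: "'a alg_closure" where v: "v \<noteq> 0" "v + inverse v = to_ac s"
    by (rule obtain_add_inverse_eq)
  have "(v + inverse v) ^ 2 = 2"
    using s by (metis v(2) to_ac_power to_ac_numeral)
  moreover have "((v + w) ^ 2 - 2) * v ^ 2 = v ^ 4 + 2 * v ^ 2 * (v * w - 1) + (v * w) ^ 2" for w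
    by (simp add: algebra_simps power2_eq_square power4_eq_xxxx)
  from this[of "inverse v"] have "((v + inverse v) ^ 2 - 2) * v ^ 2 = v ^ 4 + 1"
    using v(1) by simp
  ultimately have "v ^ 4 + 1 = 0"
    by simp
  \<comment> \<open>Hence \<open>v\<close> is a primitive eighth root of unity: among the even exponents only the multiples
    of 8 kill it, whereas \<open>q - 1\<close> and \<open>q + 1\<close> are even and not divisible by 8.\<close>
  then have v4: "v ^ 4 = -1"
    by (rule eq_neg_iff_add_eq_0[THEN iffD2])
  then have ne: "v ^ 4 \<noteq> 1"
    using two by (metis add.inverse_inverse add_eq_0_iff one_add_one)
  have v8: "v ^ 8 = 1"
    using power_mult[of v 4 2] v4 by simp
  have red: "v ^ (8 * t + r) = v ^ r" for t r
    by (simp only: power_add power_mult v8 power_one mult_1_left)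
  have v2: "v ^ 2 \<noteq> 1"
  proof
    assume "v ^ 2 = 1"
    then have "v ^ (2 * 2) = 1"
      by (simp only: power_mult power_one)
    with ne show False by simp
  qed
  have v6: "v ^ 6 \<noteq> 1"
  proof
    assume "v ^ 6 = 1"
    then have "v ^ (6 + 2) = v ^ 2"
      by (simp only: power_add mult_1_left)
    with v2 v8 show False by simp
  qed
  define t where "t = p ^ n div 8"
  have "p ^ n = 8 * t + 3 \<or> p ^ n = 8 * t + 5"
    using mod8 mult_div_mod_eq[of 8 "p ^ n", symmetric] unfolding t_def by (metis insertE empty_iff)
  then have "v ^ (p ^ n - 1) \<noteq> 1 \<and> v ^ (p ^ n + 1) \<noteq> 1"
  proof
    assume "p ^ n = 8 * t + 3"
    then have "p ^ n - 1 = 8 * t + 2" "p ^ n + 1 = 8 * t + 4" by simp_all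
    then show ?thesis using v2 ne by (simp only: red not_False_eq_True simp_thms)
  next
    assume "p ^ n = 8 * t + 5"
    then have "p ^ n - 1 = 8 * t + 4" "p ^ n + 1 = 8 * t + 6" by simp_all
    then show ?thesis using ne v6 by (simp only: red not_False_eq_True simp_thms)
  qed
  with torus_element_order[OF q v] show False by blast
qed


section \<open>Traces in \<open>SL\<^sub>2\<close>\<close>

lemma trace_2: "trace (A :: 'a :: semiring_1 ^ 2 ^ 2) = A $ 1 $ 1 + A $ 2 $ 2"
  by (simp add: trace_def sum_2)

lemma SL2_simps [simp]:
  "A \<in> carrier SL2 \<longleftrightarrow> det A = 1" "A \<otimes>\<^bsub>SL2\<^esub> B = A ** B" "\<one>\<^bsub>SL2\<^esub> = mat 1"
  by (simp_all add: SL2_def)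

interpretation SL2: group "SL2 :: ('a :: field ^ 2 ^ 2) monoid"
  by (rule group_SL2)

lemma SL2_inv_eq:
  fixes A :: "'a :: field ^ 2 ^ 2"
  assumes "det A = 1"
  shows "inv\<^bsub>SL2\<^esub> A = vector [vector [A $ 2 $ 2, - A $ 1 $ 2], vector [- A $ 2 $ 1, A $ 1 $ 1]]"
  by (rule SL2.inv_equality)
    (use assms in \<open>simp_all add: det_2 vec_eq_iff forall_2 matrix_matrix_mult_def mat_def sum_2
      algebra_simps\<close>)

text \<open>
  This is Cayley--Hamilton, \<open>A + A\<inverse> = tr A\<close>, multiplied by \<open>B\<close>. It is the source of all trace
  recursions below.
\<close>

lemma trace_mult_add_trace_inv_mult:
  fixes A B :: "'a :: field ^ 2 ^ 2"
  assumes "det A = 1"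
  shows "trace (A ** B) + trace (inv\<^bsub>SL2\<^esub> A ** B) = trace A * trace B"
  by (simp add: SL2_inv_eq[OF assms] trace_2 matrix_matrix_mult_def sum_2 algebra_simps)

lemma trace_inv:
  fixes A :: "'a :: field ^ 2 ^ 2"
  shows "det A = 1 \<Longrightarrow> trace (inv\<^bsub>SL2\<^esub> A) = trace A"
  by (simp add: SL2_inv_eq trace_2)

lemma trace_square:
  fixes A :: "'a :: field ^ 2 ^ 2"
  assumes "det A = 1"
  shows "trace (A ** A) = trace A ^ 2 - 2"
  using trace_mult_add_trace_inv_mult[OF assms, of A] SL2.l_inv[of A] assms
  by (simp add: trace_2 mat_def power2_eq_square algebra_simps)

text \<open>
  In terms of the Chebyshev polynomials \<open>U\<^sub>k\<close> of the second kind this is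
  \<open>U\<^sub>k(z / 2) - U\<^sub>k\<^sub>-\<^sub>1(z / 2)\<close>; the recursion in \<open>k\<close> is the one satisfied by the traces
  of \<open>A C\<^sup>k\<close> when \<open>tr C = z\<close>.
\<close>

fun trace_factor :: "nat \<Rightarrow> 'a :: comm_ring_1 \<Rightarrow> 'a" where
  "trace_factor 0 z = 1"
| "trace_factor (Suc 0) z = z - 1"
| "trace_factor (Suc (Suc k)) z = z * trace_factor (Suc k) z - trace_factor k z"

lemma trace_mult_pow:
  fixes A C :: "'a :: field ^ 2 ^ 2"
  assumes A: "det A = 1" and C: "det C = 1"
    and AC: "trace (A ** C) = trace A * (trace C - 1)"
  shows "trace (A ** C [^]\<^bsub>SL2\<^esub> k) = trace A * trace_factor k (trace C)"
  using AC
proof (induction k "trace C" rule: trace_factor.induct)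
  case 1
  then show ?case by simp
next
  case 2
  then show ?case using SL2.nat_pow_eone[of C] C by simp
next
  case (3 k)
  let ?B = "A ** C [^]\<^bsub>SL2\<^esub> Suc k"
  have pow: "det (C [^]\<^bsub>SL2\<^esub> j) = 1" for j :: nat
    using SL2.nat_pow_closed[of C j] C by simp
  have "C ** inv\<^bsub>SL2\<^esub> C = mat 1"
    using SL2.r_inv[of C] C by simp
  then have "trace (inv\<^bsub>SL2\<^esub> C ** ?B) = trace (A ** C [^]\<^bsub>SL2\<^esub> k)"
    unfolding trace_mul_sym[of "inv\<^bsub>SL2\<^esub> C" ?B] by (simp flip: matrix_mul_assoc)
  moreover have "trace (C ** ?B) = trace (A ** C [^]\<^bsub>SL2\<^esub> Suc (Suc k))"
    unfolding trace_mul_sym[of C ?B] by (simp add: matrix_mul_assoc)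
  ultimately show ?case
    using trace_mult_add_trace_inv_mult[OF C, of ?B] 3 by (simp add: algebra_simps)
qed

text \<open>
  The commutator enters only through the first step \<open>tr (A C) = tr A (tr C - 1)\<close> of the recursion.
  It holds because \<open>A\<inverse> C\<close> is the conjugate \<open>B A\<inverse> B\<inverse>\<close>, which has trace \<open>tr A\<close>.
\<close>

lemma trace_mult_commutator_pow:
  fixes A B :: "'a :: field ^ 2 ^ 2"
  assumes A: "det A = 1" and B: "det B = 1"
  defines "C \<equiv> A ** B ** inv\<^bsub>SL2\<^esub> A ** inv\<^bsub>SL2\<^esub> B"
  shows "trace (A ** C [^]\<^bsub>SL2\<^esub> k) = trace A * trace_factor k (trace C)"
proof (rule trace_mult_pow[OF A])
  have inv: "det (inv\<^bsub>SL2\<^esub> D) = 1" if "det D = 1" for D :: "'a ^ 2 ^ 2"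
    using SL2.inv_closed[of D] that by simp
  show "det C = 1" by (simp add: C_def det_mul A B inv)
  have AA: "inv\<^bsub>SL2\<^esub> A ** A = mat 1" and BB: "inv\<^bsub>SL2\<^esub> B ** B = mat 1"
    using SL2.l_inv[of A] SL2.l_inv[of B] A B by simp_all
  have "inv\<^bsub>SL2\<^esub> A ** C = B ** inv\<^bsub>SL2\<^esub> A ** inv\<^bsub>SL2\<^esub> B"
    by (simp add: C_def matrix_mul_assoc AA)
  then have "trace (inv\<^bsub>SL2\<^esub> A ** C) = trace A"
    by (simp add: trace_mul_sym[of _ "inv\<^bsub>SL2\<^esub> B"] matrix_mul_assoc BB trace_inv A)
  then show "trace (A ** C) = trace A * (trace C - 1)"
    using trace_mult_add_trace_inv_mult[OF A, of C] by (simp add: algebra_simps)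
qed


section \<open>Zeros of the trace factor\<close>

text \<open>
  Summing the right-hand side gives \<open>(v\<^sup>2\<^sup>k\<^sup>+\<^sup>1 + 1) / (v + 1)\<close>, which exhibits the zeros; the
  undivided sum also covers the degenerate value \<open>v = - 1\<close>, where it equals \<open>2 * k + 1\<close>.
\<close>

lemma trace_factor_geometric_sum:
  fixes v :: "'a :: field"
  assumes "v \<noteq> 0"
  shows "v ^ k * trace_factor k (v + inverse v) = (\<Sum>i\<le>2 * k. (- v) ^ i)"
proof (induction k rule: induct_nat_012)
  case 0
  show ?case by simp
next
  case 1
  show ?case using assms by (simp add: numeral_2_eq_2 field_simps)
next
  case (ge2 k)
  let ?g = "\<lambda>j. trace_factor j (v + inverse v)" and ?S = "\<lambda>j. \<Sum>i\<le>2 * j. (- v) ^ i"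
  have S: "?S (Suc j) = ?S j - v * v ^ (2 * j) + v ^ 2 * v ^ (2 * j)" for j
    by (simp add: power2_eq_square)
  have "v ^ Suc (Suc k) * ?g (Suc (Suc k)) =
      (v ^ 2 + 1) * (v ^ Suc k * ?g (Suc k)) - v ^ 2 * (v ^ k * ?g k)"
    using assms by (simp add: field_simps power2_eq_square)
  also have "\<dots> = (v ^ 2 + 1) * ?S (Suc k) - v ^ 2 * ?S k"
    by (simp only: ge2)
  also have "\<dots> = ?S (Suc (Suc k))"
    by (simp only: S) (simp add: algebra_simps power2_eq_square)
  finally show ?case .
qed

text \<open>
  At a zero, the order of \<open>- v\<close> divides the prime \<open>l = 2 * k + 1\<close> and, by the torus argument, also
  \<open>q - 1\<close> or \<open>q + 1\<close>. As \<open>l\<close> divides neither, \<open>- v = 1\<close>; then the geometric sum is \<open>l\<close>, which is not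
  zero in characteristic \<open>p \<noteq> l\<close>.
\<close>

lemma trace_factor_nonzero:
  fixes z :: "'a :: {field, finite}"
  assumes q: "CARD('a) = p ^ n" "prime p" and "odd p"
    and l: "prime (2 * k + 1)" "p \<noteq> 2 * k + 1" "\<not> [(p ^ n) ^ 2 = 1] (mod (2 * k + 1))"
  shows "trace_factor k z \<noteq> 0"
proof
  assume zero: "trace_factor k z = 0"
  let ?q = "p ^ n" and ?l = "2 * k + 1"
  obtain v :: "'a alg_closure" where v: "v \<noteq> 0" "v + inverse v = to_ac z"
    by (rule obtain_add_inverse_eq)
  have "to_ac (trace_factor j z) = trace_factor j (to_ac z)" for j
    by (induction j z rule: trace_factor.induct) auto
  then have sum0: "(\<Sum>i\<le>2 * k. (- v) ^ i) = 0"
    using trace_factor_geometric_sum[OF v(1), of k] zero v(2)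
    by (metis mult_zero_right to_ac_0)
  then have "1 - (- v) ^ Suc (2 * k) = 0"
    using sum_gp_basic[of "- v" "2 * k"] by (simp only: mult_zero_right)
  then have vl: "(- v) ^ ?l = 1"
    by (metis Suc_eq_plus1 right_minus_eq)
  obtain N where vN: "(- v) ^ N = 1" and N: "\<not> ?l dvd N"
  proof -
    \<comment> \<open>Both exponents are even, so the relation for \<open>v\<close> also holds for \<open>- v\<close>.\<close>
    have "even (?q - 1)" "even (?q + 1)" using \<open>odd p\<close> by auto
    then have "(- v) ^ (?q - 1) = 1 \<or> (- v) ^ (?q + 1) = 1"
      using torus_element_order[OF q v] by (simp only: power_minus_even)
    moreover have "?q ^ 2 - 1 = (?q - 1) * (?q + 1)"
      by (simp add: power2_eq_square algebra_simps)
    then have "\<not> ?l dvd (?q - 1) * (?q + 1)"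
      using l(3) cong_altdef_nat[of 1 "?q ^ 2" ?l] prime_gt_0_nat[OF q(2)] by simp
    then have "\<not> ?l dvd ?q - 1" "\<not> ?l dvd ?q + 1"
      using dvd_mult dvd_mult2 by blast+
    ultimately show ?thesis using that by blast
  qed
  have "coprime ?l N"
    using l(1) N by (rule prime_imp_coprime)
  then obtain a b where "?l * a = N * b + 1"
    using bezout_nat[of ?l N] by auto
  then have "((- v) ^ ?l) ^ a = ((- v) ^ N) ^ b * (- v)"
    by (simp only: power_mult[symmetric]) (simp only: power_add power_one_right)
  then have "- v = 1"
    by (simp only: vl vN power_one mult_1_left)
  with sum0 have "(\<Sum>i\<le>2 * k. 1 :: 'a alg_closure) = 0"
    by (simp only: power_one)
  then have "of_nat ?l = (0 :: 'a alg_closure)"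
    by (simp only: sum_constant card_atMost mult_1_right Suc_eq_plus1)
  then have "p dvd ?l"
    by (simp only: of_nat_eq_0_iff_char_dvd CHAR_alg_closure CHAR_eq_if_card_prime_power[OF q])
  then show False using primes_dvd_imp_eq[OF q(2) l(1)] l(2) by blast
qed


section \<open>Word maps on \<open>PSL\<^sub>2\<close>\<close>

lemma (in group_hom) hom_word_eval:
  assumes "range f \<subseteq> carrier G"
  shows "h (word_eval G f u) = word_eval H (h \<circ> f) u"
proof (induction u)
  case Nil
  then show ?case by (simp add: word_eval_def)
next
  case (Cons b u)
  have "f g \<in> carrier G" for g using assms by auto
  then show ?case
    using Cons G.word_eval_closed[OF assms, of u]
    by (cases b) (auto simp: word_eval_def)
qed

text \<open>
  Word maps commute with homomorphisms, so if a word represents a coset in the quotient, it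
  already takes a value in that coset upstairs.
\<close>

lemma (in normal) word_map_surjective_lift:
  assumes "word_map_surjective (G Mod H) w" and g: "g \<in> carrier G"
  obtains a b where "a \<in> carrier G" "b \<in> carrier G" "word_map G w (a, b) \<in> H #> g"
proof -
  interpret h: group_hom G "G Mod H" "\<lambda>a. H #> a"
    using r_coset_hom_Mod factorgroup_is_group
    by (simp add: group_hom_def group_hom_axioms_def is_group)
  have "H #> g \<in> word_map (G Mod H) w ` (carrier (G Mod H) \<times> carrier (G Mod H))"
    using assms h.hom_closed[OF g] by (simp add: word_map_surjective_def)
  then obtain a b where ab: "a \<in> carrier G" "b \<in> carrier G"
    and eq: "H #> g = word_map (G Mod H) w (H #> a, H #> b)"
    by (auto simp: carrier_FactGroup)
  note eq
  also have "\<dots> = word_eval (G Mod H) ((\<lambda>a. H #> a) \<circ> case_gen2 a b) w"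
    unfolding word_map_def prod.case
    by (intro arg_cong2[where f = "word_eval (G Mod H)"] ext refl) (simp split: gen2.split)
  also have "\<dots> = H #> word_map G w (a, b)"
    unfolding word_map_def prod.case
    by (rule h.hom_word_eval[symmetric]) (use ab in \<open>auto split: gen2.splits\<close>)
  finally have "H #> g = H #> word_map G w (a, b)" .
  moreover have "word_map G w (a, b) \<in> carrier G"
    unfolding word_map_def prod.case
    by (rule word_eval_closed) (use ab in \<open>auto split: gen2.splits\<close>)
  ultimately have "word_map G w (a, b) \<in> H #> g"
    using rcos_self[OF _ subgroup_axioms] by auto
  then show ?thesis using ab that by blast
qed

text \<open>
  The trace is defined on \<open>PSL\<^sub>2\<close> only up to sign, but whether it vanishes is well defined; the
  image of the rotation \<open>J\<close> below is an element where it does.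
\<close>

lemma word_map_not_surjective_PSL2_if_trace_nonzero:
  assumes "\<And>A B :: 'a :: field ^ 2 ^ 2. det A = 1 \<Longrightarrow> det B = 1 \<Longrightarrow>
    trace (word_map SL2 w (A, B)) \<noteq> 0"
  shows "\<not> word_map_surjective (PSL2 :: ('a ^ 2 ^ 2) set monoid) w"
proof
  assume surj: "word_map_surjective (PSL2 :: ('a ^ 2 ^ 2) set monoid) w"
  define J :: "'a ^ 2 ^ 2" where "J = vector [vector [0, 1], vector [- 1, 0]]"
  interpret normal "{mat 1, - mat 1}" "SL2 :: ('a ^ 2 ^ 2) monoid"
    by (rule normal_center_SL2)
  have "J \<in> carrier SL2" by (simp add: J_def det_2)
  then obtain A B :: "'a ^ 2 ^ 2" where "det A = 1" "det B = 1"
    and "word_map SL2 w (A, B) \<in> {mat 1, - mat 1} #>\<^bsub>SL2\<^esub> J"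
    using word_map_surjective_lift[OF surj[unfolded PSL2_def]] by auto
  then have "word_map SL2 w (A, B) \<in> {J, - J}"
    by (auto simp: r_coset_def minus_one_mult)
  then have "trace (word_map SL2 w (A, B)) = 0"
    by (auto simp: J_def trace_2)
  with assms \<open>det A = 1\<close> \<open>det B = 1\<close> show False by blast
qed

lemma trace_power_commutator_word:
  fixes A B :: "'a :: field ^ 2 ^ 2"
  assumes A: "det A = 1" and B: "det B = 1"
  obtains z where "trace (word_map SL2 (power_commutator_word k) (A, B)) =
    (trace A ^ 2 - 2) * trace_factor k z"
proof -
  have sq: "A [^]\<^bsub>SL2\<^esub> (2 :: nat) = A ** A"
    using A by (simp add: numeral_2_eq_2)
  let ?C = "A ** A ** B ** inv\<^bsub>SL2\<^esub> (A ** A) ** inv\<^bsub>SL2\<^esub> B"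
  have "word_map SL2 (power_commutator_word k) (A, B) = A ** A ** ?C [^]\<^bsub>SL2\<^esub> k"
    using SL2.word_map_power_commutator_word[of A B k] A B by (simp add: sq)
  moreover have "det (A ** A) = 1"
    by (simp add: det_mul A)
  ultimately show ?thesis
    using trace_mult_commutator_pow[of "A ** A" B k] B
    by (intro that[of "trace ?C"]) (simp only: trace_square[OF A])
qed

theorem corollary2:
  fixes k p m n :: nat
  assumes "k \<ge> 2" and "prime (2 * k + 1)"
    and "prime p" and "odd p" and "p \<noteq> 2 * k + 1"
    and "\<not> [p ^ 2 = 1] (mod 16)"
    and "\<not> [p ^ 2 = 1] (mod (2 * k + 1))"
    and "m = (LEAST j. 0 < j \<and> [p ^ (2 * j) = 1] (mod (2 * k + 1)))"
    and "n > 0" and "\<not> 2 dvd n" and "\<not> m dvd n"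
    and "CARD('a::{field, finite}) = p ^ n"
  shows "\<not> word_map_surjective (PSL2 :: ('a ^ 2 ^ 2) set monoid) (power_commutator_word k)"
proof -
  note p = \<open>prime p\<close> and l = \<open>prime (2 * k + 1)\<close> and card = \<open>CARD('a) = p ^ n\<close>
  obtain j where n: "n = 2 * j + 1"
    using \<open>\<not> 2 dvd n\<close> by (auto elim: oddE)
  \<comment> \<open>The square of an odd number is 1 or 9 modulo 16, and it is 9 exactly for 3 and 5 modulo 8.\<close>
  have "p mod 16 \<in> {1, 3, 5, 7, 9, 11, 13, 15}"
    using \<open>odd p\<close> by (simp; presburger)
  moreover have "p ^ 2 mod 16 = (p mod 16) ^ 2 mod 16"
    by (simp add: power_mod)
  ultimately have "p mod 16 \<in> {3, 5, 11, 13}"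
    using \<open>\<not> [p ^ 2 = 1] (mod 16)\<close> by (auto simp: cong_def)
  then have p8: "p mod 8 \<in> {3, 5}"
    unfolding insert_iff empty_iff by presburger
  have "p ^ 2 mod 8 = (p mod 8) ^ 2 mod 8"
    by (simp add: power_mod)
  then have "p ^ 2 mod 8 = 1"
    using p8 by auto
  then have "(p ^ 2) ^ j mod 8 = 1"
    using power_mod[of "p ^ 2" 8 j] by simp
  then have "p ^ n mod 8 = p mod 8"
    using mod_mult_right_eq[of p "(p ^ 2) ^ j" 8] by (simp add: n power_mult)
  then have two: "s ^ 2 \<noteq> 2" for s :: 'a
    using two_not_square[OF card p] p8 by simp

  \<comment> \<open>Coprimality makes the least exponent in the definition of \<open>m\<close> the multiplicative order.\<close>
  have "coprime (2 * k + 1) (p ^ 2)"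
    using l p \<open>p \<noteq> 2 * k + 1\<close> primes_coprime coprime_power_right_iff by blast
  then have "m = ord (2 * k + 1) (p ^ 2)"
    by (simp only: \<open>m = _\<close> ord_def if_True power_mult)
  then have "\<not> [(p ^ n) ^ 2 = 1] (mod (2 * k + 1))"
    using \<open>\<not> m dvd n\<close> ord_divides[of "p ^ 2" n "2 * k + 1"]
    by (simp add: mult.commute flip: power_mult)
  then have factor: "trace_factor k z \<noteq> 0" for z :: 'a
    by (rule trace_factor_nonzero[OF card p \<open>odd p\<close> l \<open>p \<noteq> 2 * k + 1\<close>])

  show ?thesis
  proof (rule word_map_not_surjective_PSL2_if_trace_nonzero)
    fix A B :: "'a ^ 2 ^ 2"
    assume "det A = 1" "det B = 1"
    then obtain z where "trace (word_map SL2 (power_commutator_word k) (A, B)) =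
        (trace A ^ 2 - 2) * trace_factor k z"
      by (rule trace_power_commutator_word)
    then show "trace (word_map SL2 (power_commutator_word k) (A, B)) \<noteq> 0"
      using two factor by simp
  qed
qed

end
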